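(* Let $A$ be an $n\times n$ matrix. Let $3\le k\le n$, and suppose Dodgson's method applied to $A$ has produced $A^{(n)}=A,\dots,A^{(k)}$ without division by zero. Suppose the interior of $A^{(k)}$ contains a zero in row $i$ and column $j$ of $A^{(k)}$, where $2\le i,j\le k-1$. Let $r,s\in\{-1,0,1\}$, and suppose the element $\alpha=A^{(k)}_{i+r,\,j+s}$ is non-zero. Let $\ell=n-k$. Let $\mathcal{A}$ be the $(\ell+3)\times(\ell+3)$ submatrix of $A$ whose upper left corner is the entry in row $i-1$ and column $j-1$ of $A$, i.e. $\mathcal{A}=A_{i-1\ldots i+\ell+1,\;j-1\ldots j+\ell+1}$. Let $M$ be the $(\ell+1)\times(\ell+1)$ submatrix of $\mathcal{A}$ whose upper left corner is the entry in row $r+2$ and column $s+2$ of $\mathcal{A}$, i.e. rows $r+2,\dots,r+2+\ell$ and columns $s+2,\dots,s+2+\ell$ of $\mathcal{A}$. Crossing out these rows and columns of $M$ leaves the $2\times 2$ complementary minor $M^*$, formed by the two remaining rows and two remaining columns of $\mathcal{A}$. Let $M'$ be the $2\times2$ matrix whose entry in each position is the minor in $\mathcal{A}$ of the corresponding element of $M^*$. Here the minor of the element in row $p$ and column $q$ of $\mathcal{A}$ is the determinant of $\mathcal{A}$ with row $p$ and column $q$ deleted. Then the element in row $i-1$ and column $j-1$ of $A^{(k-2)}$ can be computed as $\det M'/\alpha$. That is, \[ \frac{\det M'}{\alpha}=\det\mathcal{A}=\det A_{i-1\ldots i+\ell+1,\;j-1\ldots j+\ell+1}, \] which is the value that entry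 has in a successful run of Dodgson's method.
   Context: Notation: $A_{i\ldots j,\,k\ldots \ell}$ denotes the submatrix formed by rows $i,\dots,j$ and columns $k,\dots,\ell$ of $A$. The interior of an $m\times m$ matrix $X$ is the $(m-1)\times(m-1)$ matrix with $(p,q)$ entry $X_{p+1,q+1}$; an entry of $X$ is "in the interior" if it lies in rows $2,\dots,m-1$ and columns $2,\dots,m-1$. Dodgson's method for an $n\times n$ matrix $A$: set $A^{(n)}=A$. For $m=n-1,\dots,1$, let $B^{(m)}_{p,q}=A^{(m+1)}_{p,q}A^{(m+1)}_{p+1,q+1}-A^{(m+1)}_{p+1,q}A^{(m+1)}_{p,q+1}$ for $1\le p,q\le m$. Set $A^{(n-1)}=B^{(n-1)}$. For $m\le n-2$, set $A^{(m)}_{p,q}=B^{(m)}_{p,q}/A^{(m+2)}_{p+1,q+1}$. The method fails if one of these divisors is zero. When all steps succeed, $A^{(m)}_{p,q}=\det A_{p\ldots p+n-m,\;q\ldots q+n-m}$. In particular $A^{(k)}_{i+r,j+s}=\det A_{i+r\ldots i+r+\ell,\;j+s\ldots j+s+\ell}$. *)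

theory Defs
  imports "Jordan_Normal_Form.Determinant" "Jordan_Normal_Form.DL_Submatrix"
begin

text \<open>
  As everywhere in the matrix library, row and column indices start at 0; an index written
  $p$ in the usual 1-based notation is \<open>p - 1\<close> here.
\<close>

definition condense :: "'a :: field mat \<Rightarrow> 'a mat" where
  "condense X = mat (dim_row X - 1) (dim_col X - 1)
     (\<lambda>(p, q). X $$ (p, q) * X $$ (p + 1, q + 1) - X $$ (p + 1, q) * X $$ (p, q + 1))"

text \<open>\<open>dodgson_iter A t\<close> is the matrix $A^{(n-t)}$ obtained after \<open>t\<close> steps.\<close>

fun dodgson_iter :: "'a :: field mat \<Rightarrow> nat \<Rightarrow> 'a mat" where
  "dodgson_iter A 0 = A"
| "dodgson_iter A (Suc 0) = condense A"
| "dodgson_iter A (Suc (Suc t)) =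
     (let B = condense (dodgson_iter A (Suc t))
      in mat (dim_row B) (dim_col B)
           (\<lambda>(p, q). B $$ (p, q) / dodgson_iter A t $$ (p + 1, q + 1)))"

text \<open>
  \<open>dodgson A m\<close> is the \<open>m \<times> m\<close> matrix $A^{(m)}$. It is a total function because \<open>x / 0 = 0\<close>;
  it is the matrix produced by the method only if \<open>dodgson_succeeds A m\<close> holds, that is, if no
  divisor used in computing $A^{(n-2)}, \ldots, A^{(m)}$ is zero.
\<close>

definition dodgson :: "'a :: field mat \<Rightarrow> nat \<Rightarrow> 'a mat" where
  "dodgson A m = dodgson_iter A (dim_row A - m)"

definition dodgson_succeeds :: "'a :: field mat \<Rightarrow> nat \<Rightarrow> bool" where
  "dodgson_succeeds A k \<longleftrightarrow>
     (\<forall>m p q. k \<le> m \<and> m + 2 \<le> dim_row A \<and> p < m \<and> q < m \<longrightarrow>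
        dodgson A (m + 2) $$ (p + 1, q + 1) \<noteq> 0)"

definition minor :: "'a :: comm_ring_1 mat \<Rightarrow> nat \<Rightarrow> nat \<Rightarrow> 'a" where
  "minor X p q = det (mat_delete X p q)"

text \<open>
  The entry of \<open>submatrix X R C\<close> in position \<open>(a, b)\<close> is the entry of \<open>X\<close> in position
  \<open>(pick R a, pick C b)\<close>. In \<open>minor_matrix X R C\<close> every entry of \<open>submatrix X R C\<close> is replaced by
  its minor in \<open>X\<close>, without the sign of the cofactor.
\<close>

definition minor_matrix :: "'a :: comm_ring_1 mat \<Rightarrow> nat set \<Rightarrow> nat set \<Rightarrow> 'a mat" where
  "minor_matrix X R C = mat (dim_row (submatrix X R C)) (dim_col (submatrix X R C))
     (\<lambda>(a, b). minor X (pick R a) (pick C b))"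

end

theory Submission
  imports Defs "Jordan_Normal_Form.Char_Poly"
begin

text \<open>
  The theorem is the Desnanot--Jacobi identity for the rows \<open>p < p'\<close> and columns \<open>q < q'\<close> of
  \<open>X = calA\<close>: the \<open>2 \<times> 2\<close> determinant of minors equals \<open>det X\<close> times the complementary minor,
  which is \<open>\<alpha>\<close>. To prove it, multiply \<open>X\<close> by the identity matrix whose columns \<open>q\<close> and \<open>q'\<close>
  are replaced by the columns \<open>p\<close> and \<open>p'\<close> of the adjugate. In the product these columns are
  \<open>det X\<close> times unit vectors, so taking determinants gives the identity multiplied by
  \<open>det X\<close>. This factor is cancelled for the generic matrix \<open>X + t \<cdot> 1\<close>, and then \<open>t = 0\<close>.
  The case of the outermost rows and columns shows by induction that the entries of
  $A^{(m)}$ are contiguous minors of \<open>A\<close>.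
\<close>

section \<open>Determinants after replacing columns\<close>

lemma replace_col_carrier [simp]:
  "A \<in> carrier_mat n m \<Longrightarrow> replace_col A v k \<in> carrier_mat n m"
  by (auto simp: replace_col_def)

lemma cofactor_replace_col:
  assumes "A \<in> carrier_mat n n" "k < n"
  shows "cofactor (replace_col A v k) i k = cofactor A i k"
proof -
  have "mat_delete (replace_col A v k) i k = mat_delete A i k"
    using assms by (intro eq_matI) (auto simp: mat_delete_def replace_col_def)
  then show ?thesis by (simp add: cofactor_def)
qed

lemma det_replace_col:
  fixes A :: "'a :: comm_ring_1 mat"
  assumes A: "A \<in> carrier_mat n n" and k: "k < n"
  shows "det (replace_col A v k) = (\<Sum>i<n. v $ i * cofactor A i k)"
  unfolding laplace_expansion_column[OF replace_col_carrier[OF A] k] cofactor_replace_col[OF A k]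
  using A k by (intro sum.cong) (auto simp: replace_col_def)

lemma det_replace_col_smult_unit:
  fixes A :: "'a :: comm_ring_1 mat"
  assumes A: "A \<in> carrier_mat n n" and k: "k < n" and i: "i < n"
  shows "det (replace_col A (c \<cdot>\<^sub>v unit_vec n i) k) = c * cofactor A i k"
proof -
  have "(\<Sum>j<n. (c \<cdot>\<^sub>v unit_vec n i) $ j * cofactor A j k)
      = (\<Sum>j<n. if j = i then c * cofactor A j k else 0)"
    by (intro sum.cong) (auto simp: unit_vec_def)
  then show ?thesis using i by (simp add: det_replace_col[OF A k])
qed

lemma det_replace_col_unit:
  fixes A :: "'a :: comm_ring_1 mat"
  assumes "A \<in> carrier_mat n n" "k < n" "i < n"
  shows "det (replace_col A (unit_vec n i) k) = cofactor A i k"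
  using det_replace_col_smult_unit[OF assms, of 1] by simp

lemma det_replace_col_one:
  fixes v :: "'a :: comm_ring_1 vec"
  assumes v: "v \<in> carrier_vec n" and k: "k < n"
  shows "det (replace_col (1\<^sub>m n) v k) = v $ k"
  using cramer_lemma_mat[OF one_carrier_mat v k] v by simp

text \<open>Expand along column \<open>q'\<close>. Only the cofactors in rows \<open>q\<close> and
  \<open>q'\<close> survive: for any other row \<open>i\<close>, columns \<open>i\<close> and
  \<open>q'\<close> of \<open>?E i\<close> are the same unit vector.\<close>

lemma det_replace_two_cols_one:
  fixes u v :: "'a :: comm_ring_1 vec"
  assumes u: "u \<in> carrier_vec n" and v: "v \<in> carrier_vec n"
    and q: "q < n" and q': "q' < n" and neq: "q \<noteq> q'"
  shows "det (replace_col (replace_col (1\<^sub>m n) u q) v q') = u $ q * v $ q' - v $ q * u $ q'"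
proof -
  let ?Y = "replace_col (1\<^sub>m n) u q"
  have Y: "?Y \<in> carrier_mat n n" by simp
  let ?E = "\<lambda>i. replace_col ?Y (unit_vec n i) q'"
  have E: "?E i \<in> carrier_mat n n" for i by simp
  have diag: "cofactor ?Y q' q' = u $ q"
  proof -
    have "?E q' = ?Y"
      using neq q' by (intro eq_matI) (auto simp: replace_col_def)
    then show ?thesis
      using det_replace_col_unit[OF Y q' q'] det_replace_col_one[OF u q] by simp
  qed
  have swap: "cofactor ?Y q q' = - (u $ q')"
  proof -
    \<comment> \<open>\<open>?E q\<close> has \<open>u\<close> in column \<open>q\<close> and the
      unit vector of \<open>q\<close> in column \<open>q'\<close>. Exchanging them gives an identity
      with one replaced column, at the cost of a sign.\<close>
    have "?E q = swapcols q q' (replace_col (1\<^sub>m n) u q')"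
      using neq q q' by (intro eq_matI) (auto simp: replace_col_def mat_swapcols_def)
    then show ?thesis
      using det_replace_col_unit[OF Y q' q] det_replace_col_one[OF u q']
        det_swapcols[OF q q' neq, of "replace_col (1\<^sub>m n) u q'"] by simp
  qed
  have off: "cofactor ?Y i q' = 0" if i: "i < n" "i \<noteq> q" "i \<noteq> q'" for i
  proof -
    have "col (?E i) i = col (?E i) q'"
      using i q' by (intro eq_vecI) (auto simp: replace_col_def)
    then show ?thesis
      using det_replace_col_unit[OF Y q' i(1)] det_identical_columns[OF E i(3) i(1) q'] by simp
  qed
  have "(\<Sum>i<n. v $ i * cofactor ?Y i q') = (\<Sum>i\<in>{q, q'}. v $ i * cofactor ?Y i q')"
    using q q' off by (intro sum.mono_neutral_right) auto
  then show ?thesis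
    using neq by (simp add: det_replace_col[OF Y q'] diag swap algebra_simps)
qed

lemma mult_replace_col:
  assumes "X \<in> carrier_mat n n" "B \<in> carrier_mat n n" "v \<in> carrier_vec n" "k < n"
  shows "X * replace_col B v k = replace_col (X * B) (X *\<^sub>v v) k"
  using assms
  by (intro eq_matI) (auto simp: replace_col_def scalar_prod_def intro!: sum.cong)

section \<open>The Desnanot--Jacobi identity\<close>

lemma mult_adj_mat_col:
  fixes X :: "'a :: comm_ring_1 mat"
  assumes X: "X \<in> carrier_mat n n" and p: "p < n"
  shows "X *\<^sub>v col (adj_mat X) p = det X \<cdot>\<^sub>v unit_vec n p"
proof -
  have "X *\<^sub>v col (adj_mat X) p = col (X * adj_mat X) p"
    using adj_mat(1)[OF X] X p by (intro eq_vecI) auto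
  also have "\<dots> = det X \<cdot>\<^sub>v unit_vec n p"
    using p by (intro eq_vecI) (auto simp: adj_mat(2)[OF X] unit_vec_def)
  finally show ?thesis .
qed

text \<open>Both sides keep the factor \<open>det X\<close>, which may be a zero divisor in a
  commutative ring. The bracket on the left is \<open>det ?Y\<close>, up to sign: the adjugate is
  the transposed matrix of cofactors.\<close>

lemma det_mult_desnanot_jacobi:
  fixes X :: "'a :: comm_ring_1 mat"
  assumes X: "X \<in> carrier_mat n n"
    and p: "p < p'" "p' < n" and q: "q < q'" "q' < n"
  shows "det X * (minor X p q * minor X p' q' - minor X p q' * minor X p' q)
    = det X * (det X * minor (mat_delete X p' q') p q)"
proof -
  let ?u = "col (adj_mat X) p" and ?v = "col (adj_mat X) p'" and ?d = "det X"
  let ?Y = "replace_col (replace_col (1\<^sub>m n) ?u q) ?v q'"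
  have pn: "p < n" and qn: "q < n" using p q by auto
  have uv: "?u \<in> carrier_vec n" "?v \<in> carrier_vec n"
    using adj_mat(1)[OF X] by auto
  have XY: "X * ?Y = replace_col (replace_col X (?d \<cdot>\<^sub>v unit_vec n p) q) (?d \<cdot>\<^sub>v unit_vec n p') q'"
    using X p q uv by (simp add: mult_replace_col mult_adj_mat_col)
  let ?D = "mat_delete X p' q'"
  have D: "?D \<in> carrier_mat (n - 1) (n - 1)" using X by (rule mat_delete_carrier)
  \<comment> \<open>Since \<open>p < p'\<close> and \<open>q < q'\<close>, deleting row
    \<open>p'\<close> and column \<open>q'\<close> does not shift the indices \<open>p\<close> and
    \<open>q\<close>.\<close>
  have del: "mat_delete (replace_col X (?d \<cdot>\<^sub>v unit_vec n p) q) p' q'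
      = replace_col ?D (?d \<cdot>\<^sub>v unit_vec (n - 1) p) q"
    using X p q by (intro eq_matI) (auto simp: mat_delete_def replace_col_def unit_vec_def)
  have "det (X * ?Y) = ?d * ((-1) ^ (p' + q') * (?d * ((-1) ^ (p + q) * minor ?D p q)))"
    unfolding XY det_replace_col_smult_unit[OF replace_col_carrier[OF X] q(2) p(2)]
    unfolding cofactor_def del minor_def
    using p q det_replace_col_smult_unit[OF D, of q p] by (simp add: cofactor_def)
  moreover have "det (X * ?Y) = ?d * det ?Y"
    using X by (simp add: det_mult)
  moreover have "det ?Y = (-1) ^ (p + q) * minor X p q * ((-1) ^ (p' + q') * minor X p' q')
      - (-1) ^ (p' + q) * minor X p' q * ((-1) ^ (p + q') * minor X p q')"
    using X p q det_replace_two_cols_one[OF uv qn q(2)]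
    by (simp add: adj_mat_def cofactor_def minor_def)
  moreover have "(-1) ^ (p' + q) * x * ((-1) ^ (p + q') * y)
      = (-1) ^ (p + q) * ((-1) ^ (p' + q') * (x * y))" for x y :: 'a
    by (simp add: power_add mult_ac)
  \<comment> \<open>Signs and minors become variables here, so that \<open>cancel\<close> can remove
    the signs using only that they square to 1.\<close>
  ultimately have eq: "?d * (e * a * (f * b) - e * (f * (x * y))) = ?d * (f * (?d * (e * K)))"
    if "e = (-1) ^ (p + q)" "f = (-1) ^ (p' + q')" "a = minor X p q" "b = minor X p' q'"
      "x = minor X p' q" "y = minor X p q'" "K = minor ?D p q" for e f a b x y K
    using that by simp
  have sign: "(-1) ^ m * (-1) ^ m = (1 :: 'a)" for m :: nat
    by (simp flip: power_add mult_2)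
  have cancel: "d * (a * b - y * x) = d * (d * K)"
    if e: "e * e = 1" and f: "f * f = 1"
      and eq: "d * (e * a * (f * b) - e * (f * (x * y))) = d * (f * (d * (e * K)))"
    for d e f a b x y K :: 'a
  proof -
    have "d * (a * b - y * x) = (e * e) * (f * f) * (d * (a * b - y * x))"
      by (simp add: e f)
    also have "\<dots> = e * f * (d * (e * a * (f * b) - e * (f * (x * y))))"
      by (simp only: algebra_simps)
    also have "\<dots> = (e * e) * (f * f) * (d * (d * K))"
      unfolding eq by (simp only: algebra_simps)
    finally show ?thesis by (simp add: e f)
  qed
  show ?thesis
    by (rule cancel[OF sign sign eq]) (rule refl)+
qed

lemma minor_hom:
  assumes "comm_ring_hom f" "X \<in> carrier_mat n n"
  shows "minor (map_mat f X) p q = f (minor X p q)"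
    and "mat_delete (map_mat f X) p q = map_mat f (mat_delete X p q)"
proof -
  interpret comm_ring_hom f by fact
  show *: "mat_delete (map_mat f X) p q = map_mat f (mat_delete X p q)"
    using assms(2) by (intro eq_matI) (auto simp: mat_delete_def)
  show "minor (map_mat f X) p q = f (minor X p q)"
    by (simp add: minor_def * )
qed

theorem desnanot_jacobi:
  fixes X :: "'a :: idom mat"
  assumes X: "X \<in> carrier_mat n n"
    and p: "p < p'" "p' < n" and q: "q < q'" "q' < n"
  shows "minor X p q * minor X p' q' - minor X p q' * minor X p' q
    = det X * minor (mat_delete X p' q') p q"
proof -
  \<comment> \<open>\<open>char_poly_matrix (- X)\<close> is X + t * 1 over the polynomial ring. Its
    determinant is monic of degree \<open>n\<close>, hence non-zero and cancellable in that
    domain.\<close>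
  let ?Z = "char_poly_matrix (- X)" and ?f = "\<lambda>h :: 'a poly. poly h 0"
  have Z: "?Z \<in> carrier_mat n n" using X by simp
  have hom: "comm_ring_hom ?f" by (rule poly_hom.comm_ring_hom_axioms)
  have ZX: "map_mat ?f ?Z = X"
    using X by (intro eq_matI) (auto simp: char_poly_matrix_def)
  have "coeff (det ?Z) n = 1"
    using degree_monic_char_poly[of "- X" n] X by (simp add: char_poly_def)
  then have "det ?Z \<noteq> 0" by auto
  with det_mult_desnanot_jacobi[OF Z p q]
  have "minor ?Z p q * minor ?Z p' q' - minor ?Z p q' * minor ?Z p' q
      = det ?Z * minor (mat_delete ?Z p' q') p q"
    by simp
  then have "?f (minor ?Z p q * minor ?Z p' q' - minor ?Z p q' * minor ?Z p' q)
      = ?f (det ?Z * minor (mat_delete ?Z p' q') p q)"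
    by simp
  then show ?thesis
    unfolding poly_diff poly_mult minor_hom(1)[OF hom Z, symmetric]
      minor_hom(1)[OF hom mat_delete_carrier[OF Z], symmetric]
      minor_hom(2)[OF hom Z, symmetric] comm_ring_hom.hom_det[OF hom, symmetric] ZX .
qed

section \<open>Entries of the condensed matrices\<close>

text \<open>The determinants of these windows are the contiguous minors. Size 0 is useful: its
  determinant 1 puts the first condensation, which has no division, under the same formula as the
  later ones.\<close>

definition block :: "'a mat \<Rightarrow> nat \<Rightarrow> nat \<Rightarrow> nat \<Rightarrow> 'a mat" where
  "block A x y m = mat m m (\<lambda>(a, b). A $$ (x + a, y + b))"

lemma block_carrier [simp]: "block A x y m \<in> carrier_mat m m"
  by (simp add: block_def)

lemma pick_interval:
  assumes "a \<le> t"
  shows "pick {x..x + t} a = x + a"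
  using assms
proof (induction a)
  case 0
  then show ?case by (auto intro!: Least_equality)
next
  case (Suc a)
  then show ?case by (auto intro!: Least_equality)
qed

lemma submatrix_interval:
  assumes "A \<in> carrier_mat n n" "x + t < n" "y + t < n"
  shows "submatrix A {x..x + t} {y..y + t} = block A x y (t + 1)"
proof -
  have "{i. i < n \<and> i \<in> {z..z + t}} = {z..z + t}" if "z + t < n" for z
    using that by auto
  then show ?thesis
    using assms by (auto simp: submatrix_def block_def pick_interval intro!: eq_matI)
qed

text \<open>Deleting an outermost row and an outermost column of a window leaves a window, so all
  minors in the identity are contiguous.\<close>

lemma desnanot_jacobi_block:
  fixes A :: "'a :: idom mat"
  shows "det (block A x y (m + 1)) * det (block A (x + 1) (y + 1) (m + 1))
      - det (block A (x + 1) y (m + 1)) * det (block A x (y + 1) (m + 1))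
    = det (block A x y (m + 2)) * det (block A (x + 1) (y + 1) m)"
proof -
  let ?X = "block A x y (m + 2)"
  have "minor ?X 0 0 = det (block A (x + 1) (y + 1) (m + 1))"
    "minor ?X (m + 1) (m + 1) = det (block A x y (m + 1))"
    "minor ?X 0 (m + 1) = det (block A (x + 1) y (m + 1))"
    "minor ?X (m + 1) 0 = det (block A x (y + 1) (m + 1))"
    "minor (mat_delete ?X (m + 1) (m + 1)) 0 0 = det (block A (x + 1) (y + 1) m)"
    unfolding minor_def
    by (auto simp: block_def mat_delete_def intro!: arg_cong[of _ _ det] eq_matI)
  then show ?thesis
    using desnanot_jacobi[of ?X "m + 2" 0 "m + 1" 0 "m + 1"] by (simp add: mult.commute)
qed

lemma dodgson_iter_carrier:
  "A \<in> carrier_mat n n \<Longrightarrow> dodgson_iter A t \<in> carrier_mat (n - t) (n - t)"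
  by (induction A t rule: dodgson_iter.induct) (auto simp: condense_def Let_def)

text \<open>Strong induction, since a step uses the two preceding matrices. The condensed numerator
  is the wanted minor times the central minor, and the latter is exactly the divisor.\<close>

lemma dodgson_iter_eq_det_block:
  fixes A :: "'a :: field mat"
  assumes A: "A \<in> carrier_mat n n"
    and nonzero: "\<And>u x y. u + 2 \<le> t \<Longrightarrow> x + u + 2 < n \<Longrightarrow> y + u + 2 < n \<Longrightarrow>
      dodgson_iter A u $$ (x + 1, y + 1) \<noteq> 0"
    and "x + t < n" "y + t < n"
  shows "dodgson_iter A t $$ (x, y) = det (block A x y (t + 1))"
  using nonzero \<open>x + t < n\<close> \<open>y + t < n\<close>
proof (induction t arbitrary: x y rule: less_induct)
  case (less t)
  have IH: "dodgson_iter A u $$ (a, b) = det (block A a b (u + 1))"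
    if "u < t" "a + u < n" "b + u < n" for u a b
    using less.IH[OF that(1) _ that(2,3)] less.prems(1) that(1) by auto
  have condense: "condense (dodgson_iter A u) $$ (x, y)
      = det (block A x y (u + 2)) * det (block A (x + 1) (y + 1) u)" if t: "t = Suc u" for u
    using less.prems(2,3) dodgson_iter_carrier[OF A, of u] desnanot_jacobi_block[of A x y u]
    by (simp add: t condense_def IH)
  consider "t = 0" | "t = 1" | u where "t = Suc (Suc u)"
    by (metis One_nat_def not0_implies_Suc)
  then show ?case
  proof cases
    case 1
    then show ?thesis
      by (simp add: det_single block_def)
  next
    case 2
    then show ?thesis
      using condense[of 0] by (simp add: numeral_2_eq_2 block_def)
  next
    case 3
    have "det (block A (x + 1) (y + 1) (u + 1)) \<noteq> 0"
      using less.prems(1)[of u x y] less.prems(2,3) IH[of u "x + 1" "y + 1"] 3 by simp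
    moreover have "dodgson_iter A t $$ (x, y)
        = condense (dodgson_iter A (Suc u)) $$ (x, y) / dodgson_iter A u $$ (x + 1, y + 1)"
      using less.prems(2,3) dodgson_iter_carrier[OF A, of "Suc u"]
      by (simp add: 3 Let_def condense_def)
    ultimately show ?thesis
      using condense[of "Suc u"] IH[of u "x + 1" "y + 1"] less.prems(2,3) 3 by simp
  qed
qed

lemma dodgson_eq_det_block:
  fixes A :: "'a :: field mat"
  assumes A: "A \<in> carrier_mat n n" and succ: "dodgson_succeeds A k" and "k \<le> n"
    and "x < k" "y < k"
  shows "dodgson A k $$ (x, y) = det (block A x y (n - k + 1))"
proof -
  have "dodgson_iter A (n - k) $$ (x, y) = det (block A x y (n - k + 1))"
  proof (rule dodgson_iter_eq_det_block[OF A])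
    fix u a b assume u: "u + 2 \<le> n - k" "a + u + 2 < n" "b + u + 2 < n"
    \<comment> \<open>Iterate \<open>u\<close> is the divisor when the matrix of size
      \<open>n - u - 2\<close> is computed; \<open>u + 2 \<le> n - k\<close> makes the natural
      subtraction exact.\<close>
    have "dodgson A (n - u - 2 + 2) $$ (a + 1, b + 1) \<noteq> 0"
      using succ u A unfolding dodgson_succeeds_def by (elim allE impE) auto
    moreover have "n - (n - u - 2 + 2) = u" using u by simp
    ultimately show "dodgson_iter A u $$ (a + 1, b + 1) \<noteq> 0"
      using A by (simp add: dodgson_def)
  qed (use assms in auto)
  then show ?thesis using A by (simp add: dodgson_def)
qed

section \<open>Minors of the complementary minor\<close>

lemma pick_doubleton:
  assumes "p < p'"
  shows "pick {p, p'} 0 = p" "pick {p, p'} (Suc 0) = p'"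
proof -
  show *: "pick {p, p'} 0 = p"
    using assms by (auto intro!: Least_equality)
  show "pick {p, p'} (Suc 0) = p'"
    using assms unfolding pick.simps(2) * by (auto intro!: Least_equality)
qed

lemma det_mat_2:
  fixes f :: "nat \<times> nat \<Rightarrow> 'a :: comm_ring_1"
  shows "det (mat 2 2 f) = f (0, 0) * f (1, 1) - f (0, 1) * f (1, 0)"
  by (subst laplace_expansion_row[of _ 2 0])
    (auto simp: cofactor_def mat_delete_def det_single numeral_2_eq_2)

lemma det_minor_matrix_doubletons:
  fixes X :: "'a :: idom mat"
  assumes X: "X \<in> carrier_mat n n"
    and p: "p < p'" "p' < n" and q: "q < q'" "q' < n"
  shows "det (minor_matrix X {p, p'} {q, q'}) = det X * minor (mat_delete X p' q') p q"
proof -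
  have "{i. i < n \<and> i \<in> {p, p'}} = {p, p'}" "{i. i < n \<and> i \<in> {q, q'}} = {q, q'}"
    using p q by auto
  then have "minor_matrix X {p, p'} {q, q'}
      = mat 2 2 (\<lambda>(a, b). minor X (pick {p, p'} a) (pick {q, q'} b))"
    using X p q by (simp add: minor_matrix_def dim_submatrix numeral_2_eq_2)
  then show ?thesis
    using desnanot_jacobi[OF assms]
    by (simp add: det_mat_2 pick_doubleton p q del: pick.simps)
qed

text \<open>
  The \<open>let\<close> expression is the index map of \<open>mat_delete\<close> applied first at \<open>p'\<close>, then at \<open>p\<close>.
\<close>

lemma complement_interval:
  assumes "a \<le> 2"
  obtains p p' where "{0..<l + 3} - {a..a + l} = {p, p'}" "p < p'" "p' < l + 3"
    "\<And>c. c < l + 1 \<Longrightarrow>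
      (let c' = if c < p then c else Suc c in if c' < p' then c' else Suc c') = a + c"
proof -
  \<comment> \<open>The two indices outside the interval are the last two, the first and last, or
    the first two.\<close>
  consider "a = 0" | "a = 1" | "a = 2" using assms by linarith
  then show thesis
  proof cases
    case 1
    show thesis by (rule that[of "l + 1" "l + 2"]) (auto simp: 1)
  next
    case 2
    show thesis by (rule that[of 0 "l + 2"]) (auto simp: 2)
  next
    case 3
    show thesis by (rule that[of 0 1]) (auto simp: 3)
  qed
qed

theorem theorem4p3:
  fixes A calA M' :: "'a :: field mat" and \<alpha> :: 'a
    and n k l i j :: nat and r s :: int and R C :: "nat set"
  assumes A: "A \<in> carrier_mat n n"
    and k: "3 \<le> k" "k \<le> n"
    and produced: "dodgson_succeeds A k"
    and interior: "1 \<le> i" "i \<le> k - 2" "1 \<le> j" "j \<le> k - 2"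
    and zero: "dodgson A k $$ (i, j) = 0"
    and rs: "r \<in> {-1, 0, 1}" "s \<in> {-1, 0, 1}"
    and \<alpha>: "\<alpha> = dodgson A k $$ (nat (int i + r), nat (int j + s))"
    and \<alpha>_nonzero: "\<alpha> \<noteq> 0"
    and l: "l = n - k"
    and calA: "calA = submatrix A {i - 1..i + l + 1} {j - 1..j + l + 1}"
    and R: "R = {0..<l + 3} - {nat (r + 1)..nat (r + 1) + l}"
    and C: "C = {0..<l + 3} - {nat (s + 1)..nat (s + 1) + l}"
    and M': "M' = minor_matrix calA R C"
  shows "det M' / \<alpha> = det calA
    \<and> (\<forall>A' :: 'a mat. A' \<in> carrier_mat n n \<and> dodgson_succeeds A' (k - 2) \<longrightarrow>
         dodgson A' (k - 2) $$ (i - 1, j - 1)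
           = det (submatrix A' {i - 1..i + l + 1} {j - 1..j + l + 1}))"
proof -
  have sub: "submatrix B {i - 1..i + l + 1} {j - 1..j + l + 1} = block B (i - 1) (j - 1) (l + 3)"
    if "B \<in> carrier_mat n n" for B :: "'a mat"
  proof -
    have "i + l + 1 = i - 1 + (l + 2)" "j + l + 1 = j - 1 + (l + 2)"
      using interior by auto
    then show ?thesis
      using submatrix_interval[OF that, of "i - 1" "l + 2" "j - 1"] interior k l
      by (simp add: numeral_3_eq_3)
  qed
  \<comment> \<open>The 0-based corner of M inside \<open>calA\<close>, so \<open>\<alpha>\<close>
    sits at this offset from position (\<open>i - 1\<close>, \<open>j - 1\<close>).\<close>
  define a b where "a = nat (r + 1)" and "b = nat (s + 1)"
  have ab: "a \<le> 2" "b \<le> 2" using rs by (auto simp: a_def b_def)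
  have idx: "nat (int i + r) = i - 1 + a" "nat (int j + s) = j - 1 + b"
    using rs interior by (auto simp: a_def b_def)
  obtain p p' where p: "R = {p, p'}" "p < p'" "p' < l + 3"
    and pi: "\<And>c. c < l + 1 \<Longrightarrow>
      (let c' = if c < p then c else Suc c in if c' < p' then c' else Suc c') = a + c"
    using complement_interval[OF ab(1)] unfolding R a_def[symmetric] by metis
  obtain q q' where q: "C = {q, q'}" "q < q'" "q' < l + 3"
    and qi: "\<And>c. c < l + 1 \<Longrightarrow>
      (let c' = if c < q then c else Suc c in if c' < q' then c' else Suc c') = b + c"
    using complement_interval[OF ab(2)] unfolding C b_def[symmetric] by metis
  let ?X = "block A (i - 1) (j - 1) (l + 3)"
  \<comment> \<open>Deleting the complementary rows and columns leaves M, a window of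
    \<open>A\<close> whose determinant is \<open>\<alpha>\<close>.\<close>
  have "mat_delete (mat_delete ?X p' q') p q = block A (i - 1 + a) (j - 1 + b) (l + 1)"
    (is "?L = ?R")
  proof (rule eq_matI)
    fix c d assume "c < dim_row ?R" "d < dim_col ?R"
    then have c: "c < l + 1" and d: "d < l + 1" by (auto simp: block_def)
    have "?L $$ (c, d) = ?X $$
        (let c' = if c < p then c else Suc c in if c' < p' then c' else Suc c',
         let c' = if d < q then d else Suc d in if c' < q' then c' else Suc c')"
      using c d by (auto simp: mat_delete_def block_def)
    also have "\<dots> = ?X $$ (a + c, b + d)" unfolding pi[OF c] qi[OF d] ..
    finally show "?L $$ (c, d) = ?R $$ (c, d)"
      using c d ab by (simp add: block_def add.assoc)
  qed (auto simp: block_def)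
  moreover have "\<alpha> = det (block A (i - 1 + a) (j - 1 + b) (l + 1))"
    unfolding \<alpha> idx l
    by (rule dodgson_eq_det_block[OF A produced k(2)]) (use ab interior k in auto)
  ultimately have "det M' = det calA * \<alpha>"
    unfolding M' calA sub[OF A] p(1) q(1)
    by (subst det_minor_matrix_doubletons[OF block_carrier p(2,3) q(2,3)]) (simp add: minor_def)
  then have "det M' / \<alpha> = det calA" using \<alpha>_nonzero by simp
  \<comment> \<open>For \<open>A\<close> itself the zero at (\<open>i\<close>, \<open>j\<close>)
    would be a divisor, so the value of this entry in a successful run is expressed by its formula
    for every matrix \<open>A'\<close> of the same size that reaches \<open>k - 2\<close>.\<close>
  moreover have "dodgson A' (k - 2) $$ (i - 1, j - 1)
      = det (submatrix A' {i - 1..i + l + 1} {j - 1..j + l + 1})"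
    if A': "A' \<in> carrier_mat n n" and succ: "dodgson_succeeds A' (k - 2)" for A' :: "'a mat"
  proof -
    have "n - (k - 2) + 1 = l + 3" using k l by simp
    then show ?thesis
      using dodgson_eq_det_block[OF A' succ, of "i - 1" "j - 1"] interior k
      unfolding sub[OF A'] by (simp add: numeral_3_eq_3)
  qed
  ultimately show ?thesis by blast
qed

end
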